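(* For integers $N\ge 1$ let $L_3(N)=2^{2N}-2^N+1$. Then: (1) if $N\ge 1$ is an integer that is not of the form $N=3^m2^n$ with integers $m\ge 0$, $n\ge 0$, then $L_3(N)$ is composite; (2) the numbers $L_3(1)=3$, $L_3(2)=13$, $L_3(4)=241$ and $L_3(32)=18446744069414584321$ are prime.
   Context: A composite number is an integer greater than $1$ that is not prime. *)

theory Defs
  imports "HOL-Computational_Algebra.Primes"
begin

definition composite :: "int \<Rightarrow> bool" where
  "composite k \<longleftrightarrow> k > 1 \<and> \<not> prime k"

(* Integer-valued, so that the subtraction is not the truncated one of nat. *)
definition L3 :: "nat \<Rightarrow> int" where
  "L3 N = 2 ^ (2 * N) - 2 ^ N + 1"

end

theory Submission
  imports Defs "HOL-Number_Theory.Pocklington"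
begin

text \<open>
  \<open>L3 N\<close> is the sixth cyclotomic polynomial \<open>x\<^sup>2 - x + 1\<close> evaluated at \<open>2 ^ N\<close>. If \<open>N = M * k\<close>
  with \<open>k > 1\<close> coprime to 6, then \<open>k\<close>-th powers permute the primitive sixth roots of unity, so
  \<open>L3 M\<close> is a nontrivial divisor of \<open>L3 N\<close>; such a \<open>k\<close> exists unless \<open>N\<close> is a product of powers
  of 2 and 3. The value \<open>L3 32 = (2 ^ 32 - 1) * 2 ^ 32 + 1\<close> has the form required by Proth's
  primality test, whose certificate is a chain of modular squarings.
\<close>

text \<open>Since \<open>x ^ 6\<close> is 1 modulo the divisor, exponents count only modulo 6, and
  coprimality to 6 leaves the residues 1 and 5.\<close>

lemma sixth_cyclotomic_dvd_power:
  fixes x :: int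
  assumes "coprime k 6"
  shows "x\<^sup>2 - x + 1 dvd (x ^ k)\<^sup>2 - x ^ k + 1"
proof -
  let ?d = "x\<^sup>2 - x + 1"
  have "x ^ 6 - 1 = ?d * ((x + 1) * (x ^ 3 - 1))"
    by (simp add: eval_nat_numeral algebra_simps)
  then have x6: "[x ^ 6 = 1] (mod ?d)"
    by (simp add: cong_iff_dvd_diff)
  have "[x ^ k = x ^ (k mod 6)] (mod ?d)"
  proof -
    have "x ^ k = (x ^ 6) ^ (k div 6) * x ^ (k mod 6)"
      by (simp flip: power_mult power_add)
    also have "[\<dots> = 1 ^ (k div 6) * x ^ (k mod 6)] (mod ?d)"
      by (intro cong_mult cong_pow x6 cong_refl)
    finally show ?thesis by simp
  qed
  then have red: "[(x ^ k)\<^sup>2 - x ^ k + 1 = (x ^ (k mod 6))\<^sup>2 - x ^ (k mod 6) + 1] (mod ?d)"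
    by (intro cong_add cong_diff cong_pow cong_refl)
  have "\<not> 2 dvd k" "\<not> 3 dvd k"
    using coprime_common_divisor_nat[OF assms, of 2] coprime_common_divisor_nat[OF assms, of 3]
    by auto
  then have "k mod 6 = 1 \<or> k mod 6 = 5"
    by presburger
  then have "?d dvd (x ^ (k mod 6))\<^sup>2 - x ^ (k mod 6) + 1"
  proof
    assume 5: "k mod 6 = 5"
    \<comment> \<open>The cofactor is the 30th cyclotomic polynomial, as Phi_6(x^5) = Phi_6(x)
      Phi_30(x).\<close>
    have "(x ^ 5)\<^sup>2 - x ^ 5 + 1 = ?d * (x ^ 8 + x ^ 7 - x ^ 5 - x ^ 4 - x ^ 3 + x + 1)"
      by (simp add: eval_nat_numeral algebra_simps)
    then show ?thesis
      unfolding 5 by simp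
  qed simp
  then show ?thesis
    using cong_dvd_iff[OF cong_sym[OF red]] by blast
qed

text \<open>Strip the full power of 3, then that of 2. The second step passes to a divisor of
  \<open>a\<close>, so the factor 3 cannot return.\<close>

lemma ex_coprime_6_part:
  fixes N :: nat
  assumes "N > 0"
  obtains m n k where "N = 3 ^ m * 2 ^ n * k" "coprime k 6"
proof -
  define m where "m = multiplicity 3 N"
  define a where "a = N div 3 ^ m"
  define n where "n = multiplicity 2 a"
  define b where "b = a div 2 ^ n"
  have a: "N = 3 ^ m * a" "\<not> 3 dvd a"
    using assms by (simp_all add: a_def m_def multiplicity_dvd multiplicity_decompose)
  have "a \<noteq> 0"
    using a(2) by (rule contrapos_nn) simp
  then have b: "a = 2 ^ n * b" "\<not> 2 dvd b"
    by (simp_all add: b_def n_def multiplicity_dvd multiplicity_decompose)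
  have "\<not> 3 dvd b"
    using a(2) b(1) by (metis dvd_mult)
  with b(2) have "coprime b 2" "coprime b 3"
    by (simp_all add: coprime_commute[of b] prime_imp_coprime)
  then have "coprime b (2 * 3)"
    by (simp only: coprime_mult_right_iff)
  then have "coprime b 6"
    by simp
  moreover have "N = 3 ^ m * 2 ^ n * b"
    by (simp only: a(1) b(1) mult.assoc)
  ultimately show ?thesis
    using that by blast
qed

lemma L3_eq: "L3 N = (2 ^ N)\<^sup>2 - 2 ^ N + 1"
  by (simp add: L3_def power_mult mult.commute)

lemma L3_gt_1:
  assumes "N > 0"
  shows "L3 N > 1"
proof -
  have "(2::int) ^ N < 2 ^ (2 * N)"
    using assms by (intro power_strict_increasing) auto
  then show ?thesis by (simp add: L3_def)
qed

lemma L3_strict_mono: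
  assumes "M < N"
  shows "L3 M < L3 N"
proof -
  have "(2::int) ^ M < 2 ^ N"
    using assms by (intro power_strict_increasing) auto
  \<comment> \<open>The two sides are \<open>L3 M - 1\<close> and \<open>L3 N - 1\<close>.\<close>
  then have "(2::int) ^ M * (2 ^ M - 1) < 2 ^ N * (2 ^ N - 1)"
    by (intro mult_strict_mono') auto
  then show ?thesis
    by (simp add: L3_eq power2_eq_square algebra_simps)
qed

lemma composite_L3:
  assumes "N \<ge> 1" and "\<nexists>m n. N = 3 ^ m * 2 ^ n"
  shows "composite (L3 N)"
proof -
  obtain m n k where N: "N = 3 ^ m * 2 ^ n * k" and k: "coprime k 6"
    using ex_coprime_6_part[of N] assms(1) by auto
  define M where "M = (3::nat) ^ m * 2 ^ n"
  have "M > 0" by (simp add: M_def)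
  have "k \<noteq> 1" "k \<noteq> 0"
    using N assms by (metis mult_1_right, force)
  then have "M < N"
    using \<open>M > 0\<close> by (simp add: N flip: M_def)
  have "L3 M dvd L3 N"
    using sixth_cyclotomic_dvd_power[OF k, of "2 ^ M"]
    by (simp add: L3_eq N power_mult flip: M_def)
  moreover have "1 < L3 M" "L3 M < L3 N"
    using L3_gt_1 L3_strict_mono \<open>M > 0\<close> \<open>M < N\<close> by auto
  ultimately show ?thesis
    unfolding composite_def prime_int_iff
    by (metis less_irrefl order.strict_trans zero_less_one order.strict_implies_order)
qed

text \<open>This is Pocklington's criterion for n = \<open>k * 2 ^ e + 1\<close> with
  \<open>2 ^ e\<close> as the factored part of n - 1. Its only prime divisor is 2, so one exponent,
  (n - 1) / 2, has to be examined, and \<open>k < 2 ^ e\<close> makes this part large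
  enough.\<close>

lemma proth:
  fixes a k e :: nat
  assumes e: "e > 0" and k: "0 < k" "k < 2 ^ e"
    and root: "[int a ^ (k * 2 ^ (e - 1)) = - 1] (mod int (k * 2 ^ e + 1))"
  shows "prime (k * 2 ^ e + 1)"
proof (rule pocklington_alt)
  let ?n = "k * 2 ^ e + 1"
  \<comment> \<open>Here \<open>e > 0\<close> keeps \<open>e - 1\<close> from truncating.\<close>
  have half: "k * 2 ^ e = 2 * (k * 2 ^ (e - 1))"
    using e by (simp add: power_eq_if)
  show "?n \<ge> 2" "?n - 1 = 2 ^ e * k"
    using k(1) by (simp_all add: Suc_le_eq)
  have "?n \<le> (k + 1) * 2 ^ e"
    by simp
  also have "\<dots> \<le> 2 ^ e * 2 ^ e"
    using k(2) by (intro mult_le_mono1) simp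
  finally show "?n \<le> (2 ^ e)\<^sup>2"
    by (simp add: power2_eq_square)
  have minus: "[int (k * 2 ^ e) = - 1] (mod int ?n)"
    by (simp add: cong_iff_dvd_diff add.commute)
  with root have "[int (a ^ (k * 2 ^ (e - 1))) = int (k * 2 ^ e)] (mod int ?n)"
    unfolding of_nat_power by (metis cong_sym cong_trans)
  then have a: "[a ^ (k * 2 ^ (e - 1)) = k * 2 ^ e] (mod ?n)"
    by (simp only: cong_int_iff)
  from minus have "[int (k * 2 ^ e) ^ 2 = (- 1) ^ 2] (mod int ?n)"
    by (rule cong_pow)
  then have "[(k * 2 ^ e)\<^sup>2 = 1] (mod ?n)"
    by (simp flip: cong_int_iff)
  moreover have "a ^ (?n - 1) = (a ^ (k * 2 ^ (e - 1)))\<^sup>2"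
    by (simp only: half power_mult[symmetric] add_diff_cancel_right' mult.commute)
  ultimately show "[a ^ (?n - 1) = 1] (mod ?n)"
    using cong_pow[OF a, of 2] by (metis cong_trans)
  \<comment> \<open>The witness \<open>b\<close> will be \<open>k * 2 ^ e\<close>, the natural
    number representing -1. Then \<open>b - 1\<close> is n - 2, and n is odd.\<close>
  have "coprime (k * 2 ^ e - 1) ?n"
  proof (rule coprimeI)
    fix c assume c: "c dvd k * 2 ^ e - 1" "c dvd ?n"
    have "?n - (k * 2 ^ e - 1) = 2"
      using k(1) by (simp add: Suc_diff_Suc)
    then have "c dvd 2"
      using dvd_diff_nat[OF c(2) c(1)] by simp
    moreover have "odd c"
      using c(2) e by (metis dvd_trans even_add even_mult_iff even_power even_numeral odd_one)
    ultimately show "is_unit c"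
      by (metis prime_nat_iff two_is_prime_nat dvd_refl)
  qed
  moreover have "p = 2" if "prime p" "p dvd 2 ^ e" for p :: nat
    using that by (metis prime_dvd_power primes_dvd_imp_eq two_is_prime_nat)
  moreover have "(?n - 1) div 2 = k * 2 ^ (e - 1)"
    by (simp add: half)
  ultimately show "\<forall>p. prime p \<and> p dvd 2 ^ e \<longrightarrow>
      (\<exists>b. [a ^ ((?n - 1) div p) = b] (mod ?n) \<and> coprime (b - 1) ?n)"
    using a by metis
qed

text \<open>
  The quotients are part of the certificate, because the simplifier multiplies large numerals
  much faster than it divides them.
\<close>
fun square_chain :: "int \<Rightarrow> int \<Rightarrow> (int \<times> int) list \<Rightarrow> int \<Rightarrow> bool" where
  "square_chain n x [] y \<longleftrightarrow> x = y"
| "square_chain n x ((z, q) # zs) y \<longleftrightarrow> x\<^sup>2 = z + q * n \<and> square_chain n z zs y"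

lemma square_chain_cong:
  assumes "square_chain n x zs y"
  shows "[x ^ 2 ^ length zs = y] (mod n)"
  using assms
proof (induction n x zs y rule: square_chain.induct)
  case (2 n x z q zs y)
  then have "[x\<^sup>2 = z] (mod n)"
    by (simp add: cong_iff_dvd_diff)
  then have "[(x\<^sup>2) ^ 2 ^ length zs = z ^ 2 ^ length zs] (mod n)"
    by (rule cong_pow)
  moreover have "[z ^ 2 ^ length zs = y] (mod n)"
    using 2 by simp
  ultimately show ?case
    by (auto simp flip: power_mult intro: cong_trans)
qed simp

text \<open>
  The base is chosen such that its \<open>2 ^ 26\<close>-th power is 8, after which no table is needed.
\<close>
lemma pow_2_pow_31_cong_minus_1:
  "[16334397945464290598 ^ 2 ^ 31 = - 1] (mod (18446744069414584321 :: int))"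
proof -
  let ?n = "18446744069414584321 :: int" and ?b = "16334397945464290598 :: int"
  let ?zs = "[
     (7768485315656529096, 14463937659501309148),
     (8315689427686264475, 3271545584005402021),
     (7552600543241881301, 3748666452872170244),
     (9792270020272749848, 3092240817736232993),
     (3842056917760402699, 5198128829082602805),
     (2561969345295687999, 800217171321064762),
     (17585967655187380175, 355818181329769906),
     (14670161887888854203, 16765357463926230182),
     (14780543597221338054, 11666755336715449555),
     (14689788312086715899, 11842982599383662377),
     (14917392722903128661, 11697992872992012740),
     (2386580402828090423, 12063299887067022338),
     (4998280027294208343, 308768094669177466),
     (12687654034874795207, 1354320477220185802),
     (14445062887364698470, 8726557071693754699),
     (15893793146607301539, 11311472693215658241),
     (3333600369887534767, 13694159773484514074),
     (10930245224889659871, 602431051479697858),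
     (1206500561358145487, 6476495810136463474),
     (10974926054405199669, 78910597939667500),
     (8816101479115663336, 6529553478186494225),
     (4440654710286119610, 4213407254830092166),
     (14430643036723656017, 1068991589072992723),
     (14041890976876060974, 11288900505678758515),
     (2198989700608, 10688862027060733508),
     (8, 262136)] :: (int \<times> int) list"
  have "square_chain ?n ?b ?zs 8"
    by (simp only: square_chain.simps) simp
  then have "[?b ^ 2 ^ length ?zs = 8] (mod ?n)"
    by (rule square_chain_cong)
  moreover have "length ?zs = 26"
    by simp
  ultimately have "[?b ^ 2 ^ 26 = 8] (mod ?n)"
    by (simp only:)
  then have "[(?b ^ 2 ^ 26) ^ 2 ^ 5 = 8 ^ 2 ^ 5] (mod ?n)"
    by (rule cong_pow)
  moreover have "(?b ^ 2 ^ 26) ^ 2 ^ 5 = ?b ^ 2 ^ 31"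
    by (simp only: power_mult[symmetric] power_add[symmetric] numeral_plus_numeral add_num_simps)
  ultimately have "[?b ^ 2 ^ 31 = 8 ^ 2 ^ 5] (mod ?n)"
    by (simp only:)
  \<comment> \<open>With y = 2^32 the modulus is y^2 - y + 1, and 8^32 = y^3. The cofactor in y^3 +
    1 is y + 1.\<close>
  also have "[8 ^ 2 ^ 5 = - 1] (mod ?n)"
  proof -
    have "8 ^ 2 ^ 5 - (- 1) = ?n * (2 ^ 32 + 1)"
      by simp
    then show ?thesis
      unfolding cong_iff_dvd_diff by (rule dvdI)
  qed
  finally show ?thesis .
qed

text \<open>
  The simplifier decides primality of numerals by trial division, so it must never see this one.
\<close>
lemma prime_L3_32: "prime (18446744069414584321 :: nat)"
proof -
  have n: "4294967295 * 2 ^ 32 + 1 = (18446744069414584321 :: nat)"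
    by simp
  \<comment> \<open>Proth's test is applied with e = 32 and k = 2^32 - 1. As k is odd, raising to
    the k-th power preserves -1.\<close>
  have "[(16334397945464290598 ^ 2 ^ 31) ^ 4294967295 = (- 1) ^ 4294967295]
      (mod (18446744069414584321 :: int))"
    by (rule cong_pow[OF pow_2_pow_31_cong_minus_1])
  \<comment> \<open>Parity settles this without expanding the power.\<close>
  moreover have "(- 1) ^ 4294967295 = (- 1 :: int)"
    by (simp only: minus_one_power_iff odd_numeral if_False)
  moreover have "32 - 1 = (31 :: nat)"
    by simp
  ultimately have "[int 16334397945464290598 ^ (4294967295 * 2 ^ (32 - 1)) = - 1]
      (mod int (4294967295 * 2 ^ 32 + 1))"
    unfolding n of_nat_numeral mult.commute[of 4294967295 "2 ^ (32 - 1)"] power_mult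
    by (simp only:)
  then have "prime (4294967295 * 2 ^ 32 + 1 :: nat)"
    by (rule proth[rotated 3]) simp_all
  then show ?thesis
    by (simp only: n)
qed

theorem theorem5:
  "(\<forall>N::nat. N \<ge> 1 \<and> \<not> (\<exists>(m::nat) (n::nat). N = 3 ^ m * 2 ^ n) \<longrightarrow> composite (L3 N)) \<and>
   (L3 1 = 3 \<and> prime (L3 1)) \<and>
   (L3 2 = 13 \<and> prime (L3 2)) \<and>
   (L3 4 = 241 \<and> prime (L3 4)) \<and>
   (L3 32 = 18446744069414584321 \<and> prime (L3 32))"
proof -
  have L3: "L3 1 = 3" "L3 2 = 13" "L3 4 = 241" "L3 32 = 18446744069414584321"
    by (simp_all add: L3_def)
  have "prime (3::int)" "prime (13::int)" "prime (241::int)"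
    by simp_all
  moreover have "prime (18446744069414584321::int)"
    using prime_L3_32 by (simp only: of_nat_numeral flip: prime_nat_int_transfer)
  ultimately show ?thesis
    using composite_L3 unfolding L3 by blast
qed

end
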